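(* Let $F=(F_1,\dots,F_m)^\top:\mathbb{R}^n\to\mathbb{R}^m$ be continuously differentiable and let $x^0\in\mathbb{R}^n$. Let $\mathcal{L}=\{x\in\mathbb{R}^n: F_i(x)\le F_i(x^0)\ \text{for all } i\in\{1,\dots,m\}\}$. Assume: (A1) $F$ is bounded below on $\mathcal{L}$ (i.e. each $F_i$ is bounded below on $\mathcal{L}$); (A2) there are an open set $\mathcal{B}\supseteq\mathcal{L}$ and constants $L_i>0$ such that $\|\nabla F_i(x)-\nabla F_i(y)\|\le L_i\|x-y\|$ for all $x,y\in\mathcal{B}$ and $i\in\{1,\dots,m\}$. Let $\{x^k\}$ be the (infinite) sequence produced from $x^0$ by the MSD-I algorithm, with associated parameters $\tau_k>0$ and directions $v(x^k)$, and assume: (A3) there is a real number $b>0$ such that $\tau_k\le b$ for all $k$. Then $\lim_{k\to\infty}\|v(x^k)\|=0$.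
   Context: $\|\cdot\|$ and $\langle\cdot,\cdot\rangle$ are the Euclidean norm and inner product. For $x,d\in\mathbb{R}^n$ let $\psi(x,d)=\max_{1\le i\le m}\langle\nabla F_i(x),d\rangle$. The steepest descent direction $v(x)$ is the unique minimizer over $d\in\mathbb{R}^n$ of $\psi(x,d)+\tfrac12\|d\|^2$; equivalently $v(x)=-\sum_{i=1}^m\lambda_i(x)\nabla F_i(x)$, where $\lambda(x)$ is an optimal solution of $\min\{\tfrac12\|\sum_{i=1}^m\lambda_i\nabla F_i(x)\|^2:\ \lambda\in\mathbb{R}^m,\ \lambda_i\ge0,\ \sum_i\lambda_i=1\}$. MSD-I algorithm. Fix $\rho,\delta\in(0,1)$, an initial point $x^0\in\mathbb{R}^n$ and $\tau_0=1$. For $k=0,1,2,\dots$: 1. Compute an optimal solution $\lambda^k=\lambda(x^k)$ of $\min\{\tfrac12\|\sum_{i=1}^m\lambda_i\nabla F_i(x^k)\|^2:\ \lambda\in\mathbb{R}^m,\ \lambda_i\ge0,\ \sum_i\lambda_i=1\}$, and $v(x^k)=-\sum_i\lambda_i^k\nabla F_i(x^k)$. If $v(x^k)=0$, stop. 2. Set $d^k=\tau_k^{-1}v(x^k)$ and let $t_k$ be the largest value in $\{\delta^0,\delta^1,\delta^2,\dots\}$ such that $F_i(x^k+t_kd^k)\le F_i(x^k)+\rho\, t_k\,\psi(x^k,d^k)$ for all $i\in\{1,\dots,m\}$. 3. Set $x^{k+1}=x^k+t_kd^k$. 4. Set $$\tau_{k+1}=\frac{2\tau_k\left(\tau_k\sum_{i=1}^m\lambda_i^k\,(F_i(x^{k+1})-F_i(x^k))+t_k\|v(x^k)\|^2\right)}{t_k^2\|v(x^k)\|^2};$$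 if this value is negative, replace it by $\tau_{k+1}=1$. Standing convention: $\tau_k>0$ for all $k$, so that the algorithm is well defined. The algorithm is assumed not to stop, so that the sequence is infinite. *)

theory Defs
  imports "HOL-Analysis.Analysis"
begin

definition continuously_differentiable :: "('a::real_normed_vector \<Rightarrow> 'b::real_normed_vector) \<Rightarrow> bool" where
  "continuously_differentiable f \<longleftrightarrow>
     (\<exists>f' :: 'a \<Rightarrow> 'a \<Rightarrow>\<^sub>L 'b.
        (\<forall>x. (f has_derivative blinfun_apply (f' x)) (at x)) \<and> continuous_on UNIV f')"

text \<open>The gradient is only meaningful at points where \<open>f\<close> is differentiable.\<close>

definition grad :: "('a::real_inner \<Rightarrow> real) \<Rightarrow> 'a \<Rightarrow> 'a" where
  "grad f x = (THE D. GDERIV f x :> D)"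

abbreviation comp_grad :: "(real^'n \<Rightarrow> real^'m) \<Rightarrow> 'm \<Rightarrow> real^'n \<Rightarrow> real^'n" where
  "comp_grad F i \<equiv> grad (\<lambda>y. F y $ i)"

definition level_set :: "(real^'n \<Rightarrow> real^'m) \<Rightarrow> real^'n \<Rightarrow> (real^'n) set" where
  "level_set F x0 = {x. \<forall>i. F x $ i \<le> F x0 $ i}"

definition psi :: "(real^'n \<Rightarrow> real^'m) \<Rightarrow> real^'n \<Rightarrow> real^'n \<Rightarrow> real" where
  "psi F x d = Max (range (\<lambda>i. comp_grad F i x \<bullet> d))"

definition steepest_descent :: "(real^'n \<Rightarrow> real^'m) \<Rightarrow> real^'n \<Rightarrow> real^'n" where
  "steepest_descent F x =
     (THE v. is_arg_min (\<lambda>d. psi F x d + 1/2 * (norm d)\<^sup>2) (\<lambda>_. True) v)"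

definition optimal_multiplier :: "(real^'n \<Rightarrow> real^'m) \<Rightarrow> real^'n \<Rightarrow> real^'m \<Rightarrow> bool" where
  "optimal_multiplier F x l \<longleftrightarrow>
     is_arg_min (\<lambda>l. 1/2 * (norm (\<Sum>i\<in>UNIV. l $ i *\<^sub>R comp_grad F i x))\<^sup>2)
                (\<lambda>l. (\<forall>i. 0 \<le> l $ i) \<and> (\<Sum>i\<in>UNIV. l $ i) = 1) l"

definition multiplier_direction :: "(real^'n \<Rightarrow> real^'m) \<Rightarrow> real^'n \<Rightarrow> real^'m \<Rightarrow> real^'n" where
  "multiplier_direction F x l = - (\<Sum>i\<in>UNIV. l $ i *\<^sub>R comp_grad F i x)"

definition armijo_steps :: "(real^'n \<Rightarrow> real^'m) \<Rightarrow> real \<Rightarrow> real \<Rightarrow> real^'n \<Rightarrow> real^'n \<Rightarrow> real set" where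
  "armijo_steps F \<rho> \<delta> x d =
     {s. (\<exists>j::nat. s = \<delta> ^ j) \<and> (\<forall>i. F (x + s *\<^sub>R d) $ i \<le> F x $ i + \<rho> * s * psi F x d)}"

definition tau_update :: "(real^'n \<Rightarrow> real^'m) \<Rightarrow> real^'n \<Rightarrow> real^'n \<Rightarrow> real^'m \<Rightarrow> real^'n \<Rightarrow> real \<Rightarrow> real \<Rightarrow> real" where
  "tau_update F x x' l v t \<tau> =
     (let c = 2 * \<tau> * (\<tau> * (\<Sum>i\<in>UNIV. l $ i * (F x' $ i - F x $ i)) + t * (norm v)\<^sup>2)
              / (t\<^sup>2 * (norm v)\<^sup>2)
      in if c < 0 then 1 else c)"

text \<open>
  \<open>msd1_run F \<rho> \<delta> x0 x lam t \<tau>\<close> says that the sequences of iterates \<open>x\<close>, multipliers \<open>lam\<close>,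
  step sizes \<open>t\<close> and parameters \<open>\<tau>\<close> form an infinite run of the MSD-I algorithm: the condition
  \<open>v \<noteq> 0\<close> says that the stopping test fails at every iteration. Optimal multipliers need not be
  unique, so the algorithm is a relation rather than a recursive function.
\<close>

definition msd1_run ::
  "(real^'n \<Rightarrow> real^'m) \<Rightarrow> real \<Rightarrow> real \<Rightarrow> real^'n \<Rightarrow>
   (nat \<Rightarrow> real^'n) \<Rightarrow> (nat \<Rightarrow> real^'m) \<Rightarrow> (nat \<Rightarrow> real) \<Rightarrow> (nat \<Rightarrow> real) \<Rightarrow> bool" where
  "msd1_run F \<rho> \<delta> x0 x lam t \<tau> \<longleftrightarrow>
     x 0 = x0 \<and> \<tau> 0 = 1 \<and>
     (\<forall>k. let v = multiplier_direction F (x k) (lam k);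
              d = inverse (\<tau> k) *\<^sub>R v;
              S = armijo_steps F \<rho> \<delta> (x k) d
          in optimal_multiplier F (x k) (lam k) \<and>
             v \<noteq> 0 \<and>
             t k \<in> S \<and> (\<forall>s\<in>S. s \<le> t k) \<and>
             x (Suc k) = x k + t k *\<^sub>R d \<and>
             \<tau> (Suc k) = tau_update F (x k) (x (Suc k)) (lam k) v (t k) (\<tau> k))"

end

theory Submission
  imports Defs
begin

text \<open>
  The vector $p = \sum_i \lambda_i^k \nabla F_i(x^k)$ is the point of least norm in the convex hull
  of the gradients, so $\langle \nabla F_i(x^k), p\rangle \ge \|p\|^2$ for all $i$, and therefore
  $\psi(x^k, v) = -\|v\|^2$ for $v = -p$. The Armijo condition makes every $F_i(x^k)$ decrease by at
  least $\rho\,(t_k/\tau_k)\,\|v(x^k)\|^2$ per step, so it suffices to bound $t_k/\tau_k$ from below.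
  If $t_k = 1$ this is (A3). Otherwise $s = t_k/\delta$ is rejected. As \<open>\<B>\<close> need not
  be convex, the Lipschitz condition cannot be applied on the whole segment up to $s$; it is
  applied only up to the first positive $u \le s$ at which some component meets the Armijo line,
  and until then the ray stays in the level set. This gives $u \ge (1-\rho)\,\tau_k/\max_i L_i$.
\<close>

section \<open>Gradients and derivatives along lines\<close>

lemma GDERIV_unique:
  assumes "GDERIV f x :> D" "GDERIV f x :> E"
  shows "D = E"
proof -
  have "(\<lambda>h. h \<bullet> D) = (\<lambda>h. h \<bullet> E)"
    using assms unfolding gderiv_def by (rule has_derivative_unique)
  from fun_cong[OF this, of "D - E"] have "(D - E) \<bullet> (D - E) = 0"
    by (simp add: inner_diff_right)
  then show ?thesis
    by simp
qed

text \<open>The vector representing a derivative \<open>f'\<close> is \<open>adjoint f' 1\<close>;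
  its uniqueness makes the definite description in \<open>grad\<close> denote it.\<close>

lemma GDERIV_grad:
  fixes f :: "'a::euclidean_space \<Rightarrow> real"
  assumes "f differentiable (at x)"
  shows "GDERIV f x :> grad f x"
proof -
  obtain f' where f': "(f has_derivative f') (at x)"
    using assms by (auto simp: differentiable_def)
  have "(\<lambda>h. h \<bullet> adjoint f' 1) = f'"
    using adjoint_works[OF has_derivative_linear[OF f'], of _ 1] by simp
  with f' have D: "GDERIV f x :> adjoint f' 1"
    unfolding gderiv_def by (simp only:)
  then show ?thesis
    unfolding grad_def by (rule theI2) (auto intro: GDERIV_unique[OF _ D] D)
qed

lemma continuously_differentiable_GDERIV:
  assumes "continuously_differentiable F"
  shows "GDERIV (\<lambda>y. F y $ i) x :> comp_grad F i x"
proof (rule GDERIV_grad)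
  obtain f' where "(F has_derivative f') (at x)"
    using assms unfolding continuously_differentiable_def by blast
  from bounded_linear.has_derivative[OF bounded_linear_vec_nth this] show "(\<lambda>y. F y $ i) differentiable (at x)"
    by (auto simp: differentiable_def)
qed

lemma GDERIV_along_line:
  assumes "GDERIV f (x + u *\<^sub>R d) :> D"
  shows "DERIV (\<lambda>u. f (x + u *\<^sub>R d)) u :> d \<bullet> D"
proof -
  have "((\<lambda>u. x + u *\<^sub>R d) has_derivative (\<lambda>h. h *\<^sub>R d)) (at u)"
    by (auto intro!: derivative_eq_intros)
  from has_derivative_compose[OF this assms[unfolded gderiv_def]]
  have "((\<lambda>u. f (x + u *\<^sub>R d)) has_derivative (\<lambda>h. h *\<^sub>R d \<bullet> D)) (at u)" .
  moreover have "(\<lambda>h. h *\<^sub>R d \<bullet> D) = (*) (d \<bullet> D)"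
    by (simp add: fun_eq_iff mult.commute)
  ultimately show ?thesis
    unfolding has_field_derivative_def by (simp only:)
qed

section \<open>Lower bound for a rejected Armijo step\<close>

text \<open>Here \<open>p\<close> stands for the value of \<open>psi\<close> at \<open>x\<close> and
  \<open>d\<close>. The hypothesis \<open>lipschitz\<close> compares gradients only with the one at
  \<open>x\<close>, and only at points where no component has risen: such points remain in the level
  set, with no convexity involved.\<close>

lemma rejected_step_lower_bound:
  fixes f :: "'i::finite \<Rightarrow> 'a::real_inner \<Rightarrow> real" and g :: "'i \<Rightarrow> 'a \<Rightarrow> 'a"
  assumes grad: "\<And>i z. GDERIV (f i) z :> g i z"
    and slope: "\<And>i. g i x \<bullet> d \<le> p" "p < 0"
    and \<rho>: "0 < \<rho>" "\<rho> < 1"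
    and lipschitz: "\<And>i z. (\<And>j. f j z \<le> f j x) \<Longrightarrow> norm (g i z - g i x) \<le> C * norm (z - x)"
    and s: "0 < s" "f k (x + s *\<^sub>R d) \<ge> f k x + \<rho> * s * p"
    and C: "0 \<le> C"
  shows "(1 - \<rho>) * (- p) \<le> C * s * (norm d)\<^sup>2"
proof -
  \<comment> \<open>\<open>\<phi> i\<close> is the height of component \<open>i\<close> above its
    Armijo line. It vanishes at 0, with slope at most \<open>(1 - \<rho>) * p < 0\<close>
    there.\<close>
  define \<phi> where "\<phi> i u = f i (x + u *\<^sub>R d) - f i x - \<rho> * u * p" for i u
  have der: "DERIV (\<phi> i) u :> d \<bullet> g i (x + u *\<^sub>R d) - \<rho> * p" for i u
  proof -
    have "DERIV (\<lambda>u. f i (x + u *\<^sub>R d)) u :> d \<bullet> g i (x + u *\<^sub>R d)"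
      by (intro GDERIV_along_line grad)
    moreover have "DERIV (\<lambda>u. \<rho> * u * p) u :> \<rho> * p"
      by (auto intro!: derivative_eq_intros)
    ultimately have "DERIV (\<lambda>u. f i (x + u *\<^sub>R d) - f i x - \<rho> * u * p) u
        :> d \<bullet> g i (x + u *\<^sub>R d) - 0 - \<rho> * p"
      by (intro DERIV_diff DERIV_const)
    then show ?thesis
      by (simp add: \<phi>_def [abs_def])
  qed
  have \<phi>0: "\<phi> i 0 = 0" for i
    by (simp add: \<phi>_def)
  have "\<forall>i. \<exists>e>0. \<forall>h>0. h < e \<longrightarrow> \<phi> i h < 0"
  proof
    fix i
    have "\<rho> * p > 1 * p"
      using \<rho> slope(2) by (intro mult_strict_right_mono_neg) auto
    then have "d \<bullet> g i (x + 0 *\<^sub>R d) - \<rho> * p < 0"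
      using slope(1)[of i] by (simp add: inner_commute)
    from DERIV_neg_dec_right[OF der this] show "\<exists>e>0. \<forall>h>0. h < e \<longrightarrow> \<phi> i h < 0"
      by (simp add: \<phi>0)
  qed
  then obtain e where e: "\<And>i. e i > 0" "\<And>i h. 0 < h \<Longrightarrow> h < e i \<Longrightarrow> \<phi> i h < 0"
    by metis
  \<comment> \<open>Every \<open>\<phi> i\<close> vanishes at 0, so 0 must be kept out of the search
    for the first crossing. Finitely many components share a positive cutoff
    \<open>\<epsilon>\<close> before which none crosses.\<close>
  define \<epsilon> where "\<epsilon> = Min (range e)"
  have \<epsilon>: "\<epsilon> > 0" "\<And>i. \<epsilon> \<le> e i"
    by (auto simp: \<epsilon>_def e)
  define A where "A = (\<Union>i. {u \<in> {\<epsilon>..s}. \<phi> i u \<ge> 0})"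
  have cont: "continuous_on S (\<phi> i)" for i S
    using der by (meson DERIV_isCont continuous_at_imp_continuous_on)
  have "compact {u \<in> {\<epsilon>..s}. 0 \<le> \<phi> i u}" for i
  proof -
    have "closed ({\<epsilon>..s} \<inter> \<phi> i -` {0..})"
      by (intro continuous_closed_preimage cont) auto
    moreover have "{\<epsilon>..s} \<inter> \<phi> i -` {0..} = {u \<in> {\<epsilon>..s}. 0 \<le> \<phi> i u}"
      by auto
    ultimately show ?thesis
      by (auto simp: compact_eq_bounded_closed intro: bounded_subset[OF bounded_closed_interval])
  qed
  then have "compact A"
    unfolding A_def by (intro compact_UN) auto
  moreover have "A \<noteq> {}"
  proof -
    have "\<phi> k s \<ge> 0"
      using s(2) by (simp add: \<phi>_def)
    moreover have "\<epsilon> \<le> s"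
      using e(2)[of s k] \<epsilon>(2)[of k] s(1) calculation by linarith
    ultimately show ?thesis
      by (auto simp: A_def)
  qed
  ultimately obtain u where u: "u \<in> A" "\<And>w. w \<in> A \<Longrightarrow> u \<le> w"
    using compact_attains_inf by metis
  then obtain i where i: "\<phi> i u \<ge> 0" "\<epsilon> \<le> u" "u \<le> s"
    by (auto simp: A_def)
  have before: "\<phi> j w < 0" if "0 < w" "w < u" for j w
  proof (cases "w < \<epsilon>")
    case True
    then show ?thesis
      using that \<epsilon>(2)[of j] by (intro e(2)) auto
  next
    case False
    then have "w \<in> A" if "0 \<le> \<phi> j w"
      using that \<open>w < u\<close> i by (auto simp: A_def)
    then show ?thesis
      using u(2)[of w] \<open>w < u\<close> by fastforce
  qed
  have "0 < u"
    using \<epsilon> i by simp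
  \<comment> \<open>Since \<open>\<phi> i 0 = 0 \<le> \<phi> i u\<close>, the mean slope is
    nonnegative. The strict \<open>w < u\<close> puts \<open>w\<close> before the first crossing,
    where \<open>lipschitz\<close> is available.\<close>
  from MVT2[OF this der] obtain w where w: "0 < w" "w < u"
    "\<phi> i u - \<phi> i 0 = (u - 0) * (d \<bullet> g i (x + w *\<^sub>R d) - \<rho> * p)"
    by blast
  have "f j (x + w *\<^sub>R d) \<le> f j x" for j
  proof -
    \<comment> \<open>The Armijo line descends, so lying below it implies lying below the initial
      value.\<close>
    have "\<rho> * w * p \<le> 0"
      using \<rho> w slope by (simp add: mult_nonneg_nonpos)
    then show ?thesis
      using before[OF w(1,2), of j] by (simp add: \<phi>_def)
  qed
  from lipschitz[OF this, of i]
  have lip: "norm (g i (x + w *\<^sub>R d) - g i x) \<le> C * (w * norm d)"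
    using w by simp
  have "0 \<le> d \<bullet> g i (x + w *\<^sub>R d) - \<rho> * p"
    using w i \<phi>0 \<open>0 < u\<close> by (simp add: zero_le_mult_iff)
  also have "\<dots> = g i x \<bullet> d + d \<bullet> (g i (x + w *\<^sub>R d) - g i x) - \<rho> * p"
    by (simp add: inner_diff_right inner_commute)
  also have "\<dots> \<le> p + norm d * norm (g i (x + w *\<^sub>R d) - g i x) - \<rho> * p"
    using slope(1)[of i] norm_cauchy_schwarz by (smt (verit))
  also have "\<dots> \<le> p + norm d * (C * (w * norm d)) - \<rho> * p"
    using lip by (simp add: mult_left_mono)
  also have "norm d * (C * (w * norm d)) = C * w * (norm d)\<^sup>2"
    by (simp add: power2_eq_square)
  also have "\<dots> \<le> C * s * (norm d)\<^sup>2"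
    using w i C by (intro mult_right_mono mult_left_mono) auto
  finally show ?thesis
    by (simp add: algebra_simps)
qed

section \<open>Optimal multipliers and the steepest descent direction\<close>

lemma psi_upper: "comp_grad F i x \<bullet> d \<le> psi F x d"
  by (simp add: psi_def)

lemma psi_scaleR:
  assumes "0 \<le> c"
  shows "psi F x (c *\<^sub>R d) = c * psi F x d"
proof -
  have "mono ((*) c)"
    using assms by (simp add: mono_def mult_left_mono)
  from mono_Max_commute[OF this, of "range (\<lambda>i. comp_grad F i x \<bullet> d)"] show ?thesis
    by (simp add: psi_def image_image)
qed

context
  fixes F :: "real^'n \<Rightarrow> real^'m" and x :: "real^'n" and l :: "real^'m"
  assumes opt: "optimal_multiplier F x l"
begin

lemma optimal_multiplier_simplex: "0 \<le> l $ i" "(\<Sum>i\<in>UNIV. l $ i) = 1"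
  using opt by (auto simp: optimal_multiplier_def is_arg_min_linorder)

text \<open>Variational inequality for the least-norm point \<open>p\<close> of the convex hull: if
  \<open>p\<close> made an acute angle between the directions to 0 and to \<open>g j\<close>, a
  short move towards \<open>g j\<close> would reduce the norm.\<close>

lemma inner_multiplier_direction_le:
  "comp_grad F j x \<bullet> multiplier_direction F x l \<le> - (norm (multiplier_direction F x l))\<^sup>2"
proof -
  define g where "g i = comp_grad F i x" for i
  define p where "p = (\<Sum>i\<in>UNIV. l $ i *\<^sub>R g i)"
  have p: "multiplier_direction F x l = - p"
    by (simp add: multiplier_direction_def p_def g_def)
  have "\<not> 0 < (0 - p) \<bullet> (g j - p)"
  proof
    assume "0 < (0 - p) \<bullet> (g j - p)"
    then obtain u where u: "0 < u" "u \<le> 1" "norm (p + u *\<^sub>R (g j - p)) < norm p"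
      using closer_point_lemma[of 0 p "g j"] by auto
    \<comment> \<open>These are the multipliers of the moved point: a convex combination of
      \<open>l\<close> and the vertex \<open>axis j 1\<close>, hence feasible.\<close>
    define l' where "l' = l + u *\<^sub>R (axis j 1 - l)"
    have l': "l' $ i = (1 - u) * l $ i + (if i = j then u else 0)" for i
      by (simp add: l'_def axis_def algebra_simps)
    have "\<forall>i. 0 \<le> l' $ i"
      using u optimal_multiplier_simplex(1) by (auto simp: l')
    moreover have "(\<Sum>i\<in>UNIV. l' $ i) = 1"
      using optimal_multiplier_simplex(2) by (simp add: l' sum.distrib flip: sum_distrib_left)
    ultimately have "(norm p)\<^sup>2 \<le> (norm (\<Sum>i\<in>UNIV. l' $ i *\<^sub>R g i))\<^sup>2"
      using opt by (auto simp: optimal_multiplier_def is_arg_min_linorder p_def g_def)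
    moreover have "(\<Sum>i\<in>UNIV. l' $ i *\<^sub>R g i) = p + u *\<^sub>R (g j - p)"
    proof -
      have "(\<Sum>i\<in>UNIV. (if i = j then u else 0) *\<^sub>R g i) = (\<Sum>i\<in>UNIV. if i = j then u *\<^sub>R g i else 0)"
        by (intro sum.cong) auto
      moreover have "(\<Sum>i\<in>UNIV. ((1 - u) * l $ i) *\<^sub>R g i) = (1 - u) *\<^sub>R p"
        by (simp add: p_def scaleR_sum_right)
      ultimately have "(\<Sum>i\<in>UNIV. l' $ i *\<^sub>R g i) = (1 - u) *\<^sub>R p + u *\<^sub>R g j"
        unfolding l' scaleR_add_left sum.distrib by simp
      then show ?thesis
        by (simp add: algebra_simps)
    qed
    ultimately show False
      using u(3) by (simp add: power2_le_iff_abs_le)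
  qed
  then show ?thesis
    by (simp add: p inner_diff_right power2_norm_eq_inner inner_commute flip: g_def)
qed

text \<open>A weighted average of the slopes is at most their maximum.\<close>

lemma neg_inner_multiplier_direction_le_psi:
  "- (multiplier_direction F x l \<bullet> d) \<le> psi F x d"
proof -
  have "- (multiplier_direction F x l \<bullet> d) = (\<Sum>i\<in>UNIV. l $ i * (comp_grad F i x \<bullet> d))"
    by (simp add: multiplier_direction_def inner_sum_left)
  also have "\<dots> \<le> (\<Sum>i\<in>UNIV. l $ i * psi F x d)"
    by (intro sum_mono mult_left_mono psi_upper optimal_multiplier_simplex)
  also have "\<dots> = psi F x d"
    by (simp add: optimal_multiplier_simplex flip: sum_distrib_right)
  finally show ?thesis .
qed

lemma psi_multiplier_direction:
  "psi F x (multiplier_direction F x l) = - (norm (multiplier_direction F x l))\<^sup>2"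
proof (rule antisym)
  show "psi F x (multiplier_direction F x l) \<le> - (norm (multiplier_direction F x l))\<^sup>2"
    unfolding psi_def using inner_multiplier_direction_le by (intro Max.boundedI) auto
  show "- (norm (multiplier_direction F x l))\<^sup>2 \<le> psi F x (multiplier_direction F x l)"
    using neg_inner_multiplier_direction_le_psi by (simp add: power2_norm_eq_inner)
qed

text \<open>Completing the square bounds the objective below by its value at \<open>?v\<close> plus
  half the squared distance to \<open>?v\<close>. So \<open>?v\<close> is the only minimizer,
  whichever optimal multiplier was chosen.\<close>

lemma steepest_descent_eq: "steepest_descent F x = multiplier_direction F x l"
proof -
  let ?v = "multiplier_direction F x l"
  let ?q = "\<lambda>d. psi F x d + 1/2 * (norm d)\<^sup>2"
  have at: "?q ?v = - 1/2 * (norm ?v)\<^sup>2"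
    by (simp add: psi_multiplier_direction)
  have ge: "?q d \<ge> - 1/2 * (norm ?v)\<^sup>2 + 1/2 * (norm (d - ?v))\<^sup>2" for d
  proof -
    have "(norm (d - ?v))\<^sup>2 = (norm d)\<^sup>2 - 2 * (?v \<bullet> d) + (norm ?v)\<^sup>2"
      by (simp add: power2_norm_eq_inner inner_diff_left inner_diff_right inner_commute)
    with neg_inner_multiplier_direction_le_psi[of d] show ?thesis
      by linarith
  qed
  show ?thesis
    unfolding steepest_descent_def
  proof (rule the_equality)
    have "?q ?v \<le> ?q d" for d
      using ge[of d] zero_le_power2[of "norm (d - ?v)"] unfolding at by linarith
    then show "is_arg_min ?q (\<lambda>_. True) ?v"
      by (simp add: is_arg_min_linorder)
  next
    fix d assume "is_arg_min ?q (\<lambda>_. True) d"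
    then have "?q d \<le> ?q ?v"
      by (simp add: is_arg_min_linorder)
    with ge[of d] have "(norm (d - ?v))\<^sup>2 \<le> 0"
      unfolding at by linarith
    then show "d = ?v"
      by simp
  qed
qed

end

section \<open>Convergence of the MSD-I directions\<close>

theorem theorem3p1:
  fixes F :: "real^'n \<Rightarrow> real^'m"
    and x0 :: "real^'n"
    and \<rho> \<delta> b :: real
    and \<B> :: "(real^'n) set"
    and L :: "'m \<Rightarrow> real"
    and x :: "nat \<Rightarrow> real^'n"
    and lam :: "nat \<Rightarrow> real^'m"
    and t \<tau> :: "nat \<Rightarrow> real"
  assumes C1: "continuously_differentiable F"
    and A1: "\<And>i. bdd_below ((\<lambda>y. F y $ i) ` level_set F x0)"
    and A2_open: "open \<B>" "level_set F x0 \<subseteq> \<B>"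
    and A2_pos: "\<And>i. 0 < L i"
    and A2_lipschitz: "\<And>i y z. y \<in> \<B> \<Longrightarrow> z \<in> \<B> \<Longrightarrow>
           norm (comp_grad F i y - comp_grad F i z) \<le> L i * norm (y - z)"
    and params: "0 < \<rho>" "\<rho> < 1" "0 < \<delta>" "\<delta> < 1"
    and run: "msd1_run F \<rho> \<delta> x0 x lam t \<tau>"
    and tau_pos: "\<And>k. 0 < \<tau> k"
    and A3: "0 < b" "\<And>k. \<tau> k \<le> b"
  shows "(\<lambda>k. norm (steepest_descent F (x k))) \<longlonglongrightarrow> 0"
proof -
  define v where "v k = multiplier_direction F (x k) (lam k)" for k
  define d where "d k = inverse (\<tau> k) *\<^sub>R v k" for k
  have start: "x 0 = x0"
    and opt: "\<And>k. optimal_multiplier F (x k) (lam k)"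
    and v_nz: "\<And>k. v k \<noteq> 0"
    and t_mem: "\<And>k. t k \<in> armijo_steps F \<rho> \<delta> (x k) (d k)"
    and t_max: "\<And>k s. s \<in> armijo_steps F \<rho> \<delta> (x k) (d k) \<Longrightarrow> s \<le> t k"
    and step: "\<And>k. x (Suc k) = x k + t k *\<^sub>R d k"
    using run unfolding msd1_run_def Let_def v_def d_def by blast+
  have psi_d: "psi F (x k) (d k) = - ((norm (v k))\<^sup>2 / \<tau> k)" for k
    using psi_multiplier_direction[OF opt[of k]] tau_pos[of k]
    by (simp add: d_def psi_scaleR v_def divide_inverse)
  have t_pos: "0 < t k" for k
    using t_mem[of k] params by (auto simp: armijo_steps_def)

  have decrease: "F (x (Suc k)) $ i \<le> F (x k) $ i - \<rho> * (t k / \<tau> k * (norm (v k))\<^sup>2)" for k i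
    using t_mem[of k] by (simp add: armijo_steps_def step psi_d mult.assoc)
  have ratio_nonneg: "0 \<le> \<rho> * (t k / \<tau> k * (norm (v k))\<^sup>2)" for k
    using params t_pos[of k] tau_pos[of k] by (simp add: less_imp_le)
  have mono: "F (x (Suc k)) $ i \<le> F (x k) $ i" for k i
    using decrease[of k i] ratio_nonneg[of k] by linarith
  have level: "x k \<in> level_set F x0" for k
  proof (induction k)
    case (Suc k)
    then show ?case
      using mono[of k] unfolding level_set_def by (fastforce intro: order_trans)
  qed (simp add: start level_set_def)

  define C where "C = Max (range L)"
  have C: "\<And>i. L i \<le> C"
    by (simp add: C_def)
  then have "0 < C"
    using A2_pos less_le_trans by blast
  \<comment> \<open>The first term serves a full step \<open>t k = 1\<close> with
    \<open>\<tau> k \<le> b\<close>; the second comes from a rejected step, the factor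
    \<open>\<delta>\<close> converting \<open>s\<close> back to \<open>t k\<close>.\<close>
  define c where "c = min (1 / b) (\<delta> * (1 - \<rho>) / C)"
  have "0 < c"
    using A3 params \<open>0 < C\<close> by (simp add: c_def)
  have ratio: "c \<le> t k / \<tau> k" for k
  proof -
    obtain j where j: "t k = \<delta> ^ j"
      using t_mem[of k] by (auto simp: armijo_steps_def)
    show ?thesis
    proof (cases j)
      case 0
      have "1 / b \<le> 1 / \<tau> k"
        using A3 tau_pos[of k] by (simp add: frac_le)
      then show ?thesis
        using 0 j by (simp add: c_def)
    next
      case (Suc j')
      define s where "s = t k / \<delta>"
      have s: "s = \<delta> ^ j'" "0 < s"
        using Suc j params by (simp_all add: s_def)
      have "t k < s"
        using params t_pos[of k] by (simp add: s_def pos_less_divide_eq)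
      then have "s \<notin> armijo_steps F \<rho> \<delta> (x k) (d k)"
        using t_max[of s k] by auto
      then obtain i where i: "F (x k + s *\<^sub>R d k) $ i > F (x k) $ i + \<rho> * s * psi F (x k) (d k)"
        using s(1) by (auto simp: armijo_steps_def not_le)
      have lip: "norm (comp_grad F i z - comp_grad F i (x k)) \<le> C * norm (z - x k)"
        if "\<And>j. F z $ j \<le> F (x k) $ j" for i z
      proof -
        have "z \<in> level_set F x0"
          using that level[of k] unfolding level_set_def by (fastforce intro: order_trans)
        then have "norm (comp_grad F i z - comp_grad F i (x k)) \<le> L i * norm (z - x k)"
          using A2_lipschitz A2_open(2) level by blast
        also have "\<dots> \<le> C * norm (z - x k)"
          by (intro mult_right_mono C) simp
        finally show ?thesis .
      qed
      have neg: "psi F (x k) (d k) < 0"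
        using tau_pos[of k] v_nz[of k] by (simp add: psi_d)
      have "(1 - \<rho>) * (- psi F (x k) (d k)) \<le> C * s * (norm (d k))\<^sup>2"
        using continuously_differentiable_GDERIV[OF C1] psi_upper neg params(1,2) lip s(2)
          less_imp_le[OF i] less_imp_le[OF \<open>0 < C\<close>]
        by (rule rejected_step_lower_bound[where f = "\<lambda>i y. F y $ i"])
      \<comment> \<open>Isolates the factor \<open>(norm (v k))\<^sup>2 / \<tau> k\<close>, which is
        \<open>- psi F (x k) (d k)\<close> and cancels against the left side.\<close>
      also have "\<dots> = (C * s / \<tau> k) * ((norm (v k))\<^sup>2 / \<tau> k)"
        using tau_pos[of k] by (simp add: d_def power_mult_distrib divide_inverse power2_eq_square)
      finally have "1 - \<rho> \<le> C * s / \<tau> k"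
        using neg unfolding psi_d by (simp only: minus_minus neg_less_0_iff_less mult_le_cancel_right_pos)
      then have "\<delta> * (1 - \<rho>) / C \<le> t k / \<tau> k"
        using params \<open>0 < C\<close> tau_pos[of k] by (simp add: s_def field_simps)
      then show ?thesis
        by (simp add: c_def)
    qed
  qed

  have "(\<lambda>k. norm (v k)) \<longlonglongrightarrow> 0"
  proof -
    \<comment> \<open>One component suffices: its values decrease and are bounded below, so they
      converge, and their successive differences, which dominate the squared norms, tend to
      0.\<close>
    fix i :: 'm
    let ?f = "\<lambda>k. F (x k) $ i"
    obtain B where B: "\<And>y. y \<in> level_set F x0 \<Longrightarrow> B \<le> F y $ i"
      using A1[of i] by (auto simp: bdd_below_def)
    have "decseq ?f"
      by (intro decseq_SucI mono)
    then obtain l where l: "?f \<longlonglongrightarrow> l"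
      using decseq_convergent[of ?f B] B level by blast
    have "(\<lambda>k. (?f k - ?f (Suc k)) / (\<rho> * c)) \<longlonglongrightarrow> (l - l) / (\<rho> * c)"
      using params \<open>0 < c\<close> by (intro tendsto_intros LIMSEQ_Suc l) simp
    then have lim: "(\<lambda>k. (?f k - ?f (Suc k)) / (\<rho> * c)) \<longlonglongrightarrow> 0"
      by simp
    have bound: "(norm (v k))\<^sup>2 \<le> (?f k - ?f (Suc k)) / (\<rho> * c)" for k
    proof -
      have "\<rho> * (c * (norm (v k))\<^sup>2) \<le> \<rho> * (t k / \<tau> k * (norm (v k))\<^sup>2)"
        using params by (intro mult_left_mono mult_right_mono ratio) auto
      with decrease[of k i] show ?thesis
        using params \<open>0 < c\<close> by (simp add: pos_le_divide_eq mult_ac)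
    qed
    have "(\<lambda>k. (norm (v k))\<^sup>2) \<longlonglongrightarrow> 0"
      by (rule tendsto_sandwich[OF _ _ tendsto_const lim]) (auto intro!: always_eventually bound)
    from tendsto_real_sqrt[OF this] show ?thesis
      by simp
  qed
  then show ?thesis
    by (simp add: steepest_descent_eq[OF opt] v_def)
qed

end
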